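(* Let $X$ be a reflexive Banach space and let $Z$ be a Hausdorff topological vector space. Let $C\subseteq Z$ be a convex and pointed cone with nonempty interior, and let $K$ be a nonempty, convex and closed subset of $X$. Consider a mapping $F:K\times K\times K\to Z$ satisfying: (i) for every $y\in K$, one of the following conditions is satisfied with respect to the weak topology of $X$ (that is, convergence of nets in $K$ and neighborhoods of points of $K$ are taken in the weak topology): (a) for every net $(x_\alpha)\subseteq K$ with $\lim x_\alpha=x$: if $F(x_\alpha,y,x_\alpha)\notin-\operatorname{int}C$ for all $\alpha$, then $F(x,y,x)\notin-\operatorname{int}C$; (b) the mapping $x\mapsto F(x,y,x)$ is $C$-upper semicontinuous on $K$; (c) for every $x\in K$ and every net $(x_\alpha)\subseteq K$ with $\lim x_\alpha=x$ there exists a net $(z_\alpha)\subseteq Z$ with $\lim z_\alpha=z$ such that $F(x_\alpha,y,x_\alpha)-z_\alpha\in-C$ and $F(x,y,x)-z\in C$; (ii) for every $x\in K$, the mapping $y\mapsto F(x,y,x)$ is $C$-convex on $K$; (iii) for every $x\in K$, $F(x,x,x)\in(-C)\setminus(-\operatorname{int}C)$; (iv) there exists $r>0$ such that, for all $x\in K$ with $\|x\|>r$, there exists $y_0\in K$ with $\|y_0\|<\|x\|$ such that $F(x,y_0,x)\in-C$. Then there exists an element $x_0\in K$ such that $F(x_0,y,x_0)\notin-\operatorname{int}C$ for all $y\in K$.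
   Context: All spaces are real. A cone $C$ satisfies $tc\in C$ for all $c\in C$, $t\ge 0$; it is convex if $C+C=C$ and pointed if $C\cap(-C)=\{0\}$ ($C$ is not assumed closed). $\operatorname{int}C$ is the interior of $C$. A map $f:K\to Z$ is $C$-upper semicontinuous at $x\in K$ if for any neighborhood $V$ of $f(x)$ there exists a neighborhood $U$ of $x$ such that $f(u)\in V-C$ for all $u\in U\cap K$; it is $C$-upper semicontinuous on $K$ if this holds at every $x\in K$. A map $f:K\to Z$ ($K$ convex) is $C$-convex if $tf(x)+(1-t)f(y)-f(tx+(1-t)y)\in C$ for all $x,y\in K$, $t\in[0,1]$. *)

theory Defs
  imports "HOL-Analysis.Analysis"
begin

class real_topological_vector_space = real_vector + topological_ab_group_add +
  assumes tendsto_scaleR_Pair: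
    "LIM x (nhds t \<times>\<^sub>F nhds a). fst x *\<^sub>R snd x :> nhds (t *\<^sub>R a)"

instance real_normed_vector < real_topological_vector_space
proof
  fix t :: real and a :: 'a
  have "((\<lambda>x. x) \<longlongrightarrow> (t, a)) (nhds (t, a))"
    by (rule filterlim_ident)
  from tendsto_scaleR[OF tendsto_fst[OF this] tendsto_snd[OF this]]
  show "LIM x (nhds t \<times>\<^sub>F nhds a). fst x *\<^sub>R snd x :> nhds (t *\<^sub>R a)"
    by (simp only: nhds_prod fst_conv snd_conv)
qed

definition bidual_embedding ::
    "'a::real_normed_vector \<Rightarrow> ('a \<Rightarrow>\<^sub>L real) \<Rightarrow>\<^sub>L real" where
  "bidual_embedding x = Blinfun (\<lambda>\<phi>. blinfun_apply \<phi> x)"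

lemma bidual_embedding_apply:
  "blinfun_apply (bidual_embedding x) \<phi> = blinfun_apply \<phi> x"
  unfolding bidual_embedding_def
  by (simp add: bounded_linear_Blinfun_apply
      bounded_bilinear.bounded_linear_left[OF bounded_bilinear_blinfun_apply])

definition reflexive_space :: "'a::real_normed_vector itself \<Rightarrow> bool" where
  "reflexive_space _ \<longleftrightarrow>
     surj (bidual_embedding :: 'a \<Rightarrow> ('a \<Rightarrow>\<^sub>L real) \<Rightarrow>\<^sub>L real)"

definition weak_topology :: "'a::real_normed_vector topology" where
  "weak_topology = topology_generated_by
     {blinfun_apply \<phi> -` U | (\<phi> :: 'a \<Rightarrow>\<^sub>L real) U. open U}"

lemma topspace_weak_topology [simp]: "topspace weak_topology = UNIV"
  proof -
  have "x \<in> blinfun_apply (0 :: 'a \<Rightarrow>\<^sub>L real) -` UNIV" for x :: 'a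
    by simp
  then show ?thesis
    unfolding weak_topology_def topology_generated_by_topspace by blast
qed

text \<open>
  A net is a function on a nonempty set \<open>A\<close> that is upwards directed by a preorder \<open>r\<close>, where
  \<open>(a, b) \<in> r\<close> reads "\<open>b\<close> is at or beyond \<open>a\<close>". Its limits are its limits along the filter
  of tails.
\<close>

definition directed_on :: "'i set \<Rightarrow> 'i rel \<Rightarrow> bool" where
  "directed_on A r \<longleftrightarrow> preorder_on A r \<and> A \<noteq> {} \<and>
     (\<forall>a\<in>A. \<forall>b\<in>A. \<exists>c\<in>A. (a, c) \<in> r \<and> (b, c) \<in> r)"

definition tails :: "'i set \<Rightarrow> 'i rel \<Rightarrow> 'i filter" where
  "tails A r = (INF a\<in>A. principal {b \<in> A. (a, b) \<in> r})"

lemma eventually_tails: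
  assumes "directed_on A r"
  shows "eventually P (tails A r) \<longleftrightarrow> (\<exists>a\<in>A. \<forall>b\<in>A. (a, b) \<in> r \<longrightarrow> P b)"
  unfolding tails_def
proof (subst eventually_INF_base)
  show "A \<noteq> {}" using assms by (simp add: directed_on_def)
next
  fix a b assume "a \<in> A" "b \<in> A"
  then obtain c where c: "c \<in> A" "(a, c) \<in> r" "(b, c) \<in> r"
    using assms unfolding directed_on_def by blast
  moreover have "trans r" using assms by (simp add: directed_on_def preorder_on_def)
  ultimately show "\<exists>x\<in>A. principal {b \<in> A. (x, b) \<in> r}
      \<le> inf (principal {b \<in> A. (a, b) \<in> r}) (principal {ba \<in> A. (b, ba) \<in> r})"
    by (intro bexI[of _ c]) (auto elim: transE)
qed (auto simp: eventually_principal)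

text \<open>
  HOL cannot quantify over index types inside a hypothesis, so nets in a space \<open>'a\<close> are indexed by
  subsets of one type. The pairs (neighbourhood, point) suffice to reach every point of the closure
  of a set in any topology on \<open>'a\<close> by a net from that set. Requiring a hypothesis only for these
  nets is weaker than requiring it for nets over arbitrary index sets.
\<close>

type_synonym 'a net_index = "'a set \<times> 'a"

definition C_upper_semicontinuous_on ::
    "'a topology \<Rightarrow> 'z::real_topological_vector_space set \<Rightarrow> 'a set \<Rightarrow> ('a \<Rightarrow> 'z) \<Rightarrow> bool" where
  "C_upper_semicontinuous_on T C K f \<longleftrightarrow>
     (\<forall>x\<in>K. \<forall>V. open V \<and> f x \<in> V \<longrightarrow>
        (\<exists>U. openin T U \<and> x \<in> U \<and> (\<forall>u\<in>U \<inter> K. f u \<in> {v - c | v c. v \<in> V \<and> c \<in> C})))"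

definition C_convex_on ::
    "'z::real_vector set \<Rightarrow> 'a::real_vector set \<Rightarrow> ('a \<Rightarrow> 'z) \<Rightarrow> bool" where
  "C_convex_on C K f \<longleftrightarrow>
     (\<forall>x\<in>K. \<forall>y\<in>K. \<forall>t\<in>{0..1::real}.
        t *\<^sub>R f x + (1 - t) *\<^sub>R f y - f (t *\<^sub>R x + (1 - t) *\<^sub>R y) \<in> C)"

end

theory Submission
  imports Defs
begin

text \<open>
  Write \<open>N = - int C\<close>. For a bound \<open>R\<close> that exceeds the radius of the coercivity hypothesis, let
  \<open>M\<close> be the part of \<open>K\<close> of norm at most \<open>R\<close>, and for \<open>y \<in> M\<close> let \<open>G y\<close> be the set of those
  \<open>x \<in> M\<close> with \<open>F x y x \<notin> N\<close>. A point common to all \<open>G y\<close> solves the problem on \<open>M\<close>, and such a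
  point exists by the Knaster-Kuratowski-Mazurkiewicz principle in the weak topology:

  \<^item> \<open>M\<close> is weakly compact, because the space is reflexive and \<open>M\<close> is closed, convex and bounded
  (\<open>weakly_compact_closed_convex_bounded\<close>).

  \<^item> Each \<open>G y\<close> is weakly closed. Each of the three alternatives of the first hypothesis gives
  this, since \<open>N\<close> is open and absorbs the subtraction of elements of \<open>C\<close>
  (\<open>weakly_closed_solution_set\<close>).

  \<^item> The hull of finitely many points of \<open>M\<close> is covered by their sets \<open>G y\<close>. Otherwise some \<open>x\<close> in
  the hull of \<open>T\<close> has \<open>F x y x \<in> N\<close> for all \<open>y \<in> T\<close>. By \<open>C\<close>-convexity the \<open>y\<close> with this property
  form a convex set (\<open>convex_neg_interior_sublevel\<close>), so it contains \<open>x\<close> itself, whereas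
  \<open>F x x x \<notin> N\<close>.

  A solution \<open>x\<close> on \<open>M\<close> is a solution on \<open>K\<close>: coercivity, or \<open>y\<^sub>0 = x\<close> when \<open>x\<close> has norm less than
  \<open>R\<close>, gives a point \<open>y\<^sub>0 \<in> K\<close> of norm less than \<open>R\<close> with \<open>F x y\<^sub>0 x \<in> - C\<close>. If \<open>F x y x \<in> N\<close> for some
  \<open>y \<in> K\<close>, then \<open>F x w x \<in> N\<close> for every \<open>w \<noteq> y\<^sub>0\<close> on the segment from \<open>y\<^sub>0\<close> to \<open>y\<close>, and those \<open>w\<close> that
  are close to \<open>y\<^sub>0\<close> lie in \<open>M\<close>.

  Two bodies of theory support this. Weak closedness of closed convex sets and weak compactness come
  from the Hahn-Banach theorem and from Tychonoff's theorem. The KKM principle for finitely many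
  points comes from Brouwer's theorem on a cube whose dimension is a natural number rather than a
  type, because the number of points varies within the proof; it is derived from Kuhn's
  combinatorial lemma.
\<close>

section \<open>Sublinear functionals and the Hahn-Banach theorem\<close>

definition sublinear :: "('a::real_vector \<Rightarrow> real) \<Rightarrow> bool" where
  "sublinear q \<longleftrightarrow> (\<forall>x y. q (x + y) \<le> q x + q y) \<and> (\<forall>t\<ge>0. \<forall>x. q (t *\<^sub>R x) = t * q x)"

lemma sublinear_add: "sublinear q \<Longrightarrow> q (x + y) \<le> q x + q y"
  by (simp add: sublinear_def)

lemma sublinear_scaleR: "sublinear q \<Longrightarrow> t \<ge> 0 \<Longrightarrow> q (t *\<^sub>R x) = t * q x"
  by (simp add: sublinear_def)

lemma sublinear_zero: "sublinear q \<Longrightarrow> q 0 = 0"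
  using sublinear_scaleR[of q 0 0] by simp

lemma sublinear_minus: "sublinear q \<Longrightarrow> - q (- x) \<le> q x"
  using sublinear_add[of q x "- x"] sublinear_zero[of q] by simp

text \<open>
  For an infimum of functionals one half of positive homogeneity follows by comparing terms. It
  suffices, because the other half is the same inequality for \<open>inverse t\<close>.
\<close>
lemma sublinearI:
  assumes add: "\<And>x y. q (x + y) \<le> q x + q y"
    and scale: "\<And>t x. t > 0 \<Longrightarrow> q (t *\<^sub>R x) \<le> t * q x"
    and zero: "q 0 = 0"
  shows "sublinear q"
  unfolding sublinear_def
proof (intro conjI allI impI)
  fix t :: real and x assume "t \<ge> 0"
  show "q (t *\<^sub>R x) = t * q x"
  proof (cases "t = 0")
    case False
    with \<open>t \<ge> 0\<close> have "t > 0" by simp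
    have "q x \<le> inverse t * q (t *\<^sub>R x)"
      using scale[of "inverse t" "t *\<^sub>R x"] \<open>t > 0\<close> by simp
    then have "t * q x \<le> q (t *\<^sub>R x)"
      using \<open>t > 0\<close> by (simp add: field_simps)
    with scale[OF \<open>t > 0\<close>, of x] show ?thesis by simp
  qed (simp add: zero)
qed (rule add)

text \<open>
  Zorn's lemma applies because the pointwise infimum of a chain of sublinear functionals below \<open>p\<close>
  is finite, being bounded below by \<open>- p (- x)\<close>, and is again sublinear.
\<close>
lemma minimal_sublinear_exists:
  assumes p: "sublinear p"
  obtains q where "sublinear q" "\<And>x. q x \<le> p x"
    "\<And>q'. sublinear q' \<Longrightarrow> (\<And>x. q' x \<le> q x) \<Longrightarrow> q' = q"
proof -
  let ?A = "{q. sublinear q \<and> q \<le> p}"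
  let ?P = "\<lambda>f g :: 'a \<Rightarrow> real. g \<le> f"
  have "\<exists>m\<in>?A. \<forall>a\<in>?A. ?P m a \<longrightarrow> a = m"
  proof (rule predicate_Zorn)
    show "partial_order_on ?A (relation_of ?P ?A)"
      by (auto simp: partial_order_on_def preorder_on_def relation_of_def refl_on_def
          trans_def antisym_def)
  next
    fix C assume C: "C \<in> Chains (relation_of ?P ?A)"
    show "\<exists>u\<in>?A. \<forall>a\<in>C. ?P a u"
    proof (cases "C = {}")
      case True
      then show ?thesis using p by auto
    next
      case False
      have sub: "sublinear f" and le: "f x \<le> p x" if "f \<in> C" for f x
        using C that by (auto simp: Chains_def relation_of_def le_fun_def)
      have tot: "f \<le> g \<or> g \<le> f" if "f \<in> C" "g \<in> C" for f g
        using C that by (auto simp: Chains_def relation_of_def)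
      define q where "q x = (INF f\<in>C. f x)" for x
      have bdd: "bdd_below ((\<lambda>f. f x) ` C)" for x
      proof (rule bdd_belowI2)
        fix f assume "f \<in> C"
        then show "- p (- x) \<le> f x"
          using sublinear_minus[OF sub[OF \<open>f \<in> C\<close>], of x] le[of f "- x"] by simp
      qed
      have lower: "q x \<le> f x" if "f \<in> C" for f x
        unfolding q_def by (rule cINF_lower[OF bdd that])
      have great: "c \<le> q x" if "\<And>f. f \<in> C \<Longrightarrow> c \<le> f x" for c x
        unfolding q_def by (rule cINF_greatest[OF False that])
      have "sublinear q"
      proof (rule sublinearI)
        fix x y
        \<comment> \<open>Subadditivity of \<open>q\<close> needs one functional that is below both \<open>f\<close> and \<open>g\<close>; in a chain
             the smaller of the two will do.\<close>
        have "q (x + y) \<le> f x + g y" if "f \<in> C" "g \<in> C" for f g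
          using tot[OF that]
        proof
          assume "f \<le> g"
          then show ?thesis
            using lower[OF that(1), of "x + y"] sublinear_add[OF sub[OF that(1)], of x y]
            by (auto simp: le_fun_def) (smt (verit))
        next
          assume "g \<le> f"
          then show ?thesis
            using lower[OF that(2), of "x + y"] sublinear_add[OF sub[OF that(2)], of x y]
            by (auto simp: le_fun_def) (smt (verit))
        qed
        then have "q (x + y) - g y \<le> q x" if "g \<in> C" for g
          using that by (intro great) (simp add: algebra_simps)
        then have "q (x + y) - q x \<le> q y"
          by (intro great) (simp add: algebra_simps)
        then show "q (x + y) \<le> q x + q y" by simp
      next
        fix t :: real and x assume t: "t > 0"
        have "q (t *\<^sub>R x) / t \<le> q x"
        proof (rule great)
          fix f assume f: "f \<in> C"
          show "q (t *\<^sub>R x) / t \<le> f x"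
            using lower[OF f, of "t *\<^sub>R x"] sublinear_scaleR[OF sub[OF f], of t x] t
            by (simp add: field_simps)
        qed
        then show "q (t *\<^sub>R x) \<le> t * q x" using t by (simp add: field_simps)
      next
        show "q 0 = 0"
        proof -
          have "(INF f\<in>C. f 0) = (INF f\<in>C. 0::real)"
            by (rule INF_cong) (simp_all add: sub sublinear_zero)
          then show ?thesis using False by (simp add: q_def)
        qed
      qed
      moreover have "q \<le> p"
        using False lower le by (meson all_not_in_conv le_fun_def order_trans)
      ultimately show ?thesis using lower by (auto simp: le_fun_def)
    qed
  qed
  then obtain q where "sublinear q" "q \<le> p" "\<And>q'. sublinear q' \<Longrightarrow> q' \<le> p \<Longrightarrow> q' \<le> q \<Longrightarrow> q' = q"
    by blast
  then show thesis
    by (intro that[of q]) (auto simp: le_fun_def, meson order_trans)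
qed

text \<open>
  For a direction \<open>y\<close> the functional \<open>h x = (INF t\<in>{0..}. q (x + t y) - t q y)\<close> is sublinear and
  below \<open>q\<close>. Minimality makes it equal to \<open>q\<close>, and its term for \<open>t = 1\<close> then gives
  \<open>q x + q y \<le> q (x + y)\<close>, the inequality that turns subadditivity into additivity.
\<close>
lemma minimal_sublinear_imp_linear:
  assumes q: "sublinear q"
    and min: "\<And>q'. sublinear q' \<Longrightarrow> (\<And>x. q' x \<le> q x) \<Longrightarrow> q' = q"
  shows "linear q"
proof -
  have add: "q (x + y) = q x + q y" for x y
  proof -
    define h where "h x = (INF t\<in>{0..}. q (x + t *\<^sub>R y) - t * q y)" for x
    have bdd: "bdd_below ((\<lambda>t. q (x + t *\<^sub>R y) - t * q y) ` {0..})" for x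
    proof (rule bdd_belowI2)
      fix t :: real assume "t \<in> {0..}"
      then show "- q (- x) \<le> q (x + t *\<^sub>R y) - t * q y"
        using sublinear_add[OF q, of "x + t *\<^sub>R y" "- x"] sublinear_scaleR[OF q, of t y] by simp
    qed
    have lower: "h x \<le> q (x + t *\<^sub>R y) - t * q y" if "t \<ge> 0" for x t
      unfolding h_def by (rule cINF_lower[OF bdd]) (use that in auto)
    have great: "c \<le> h x" if "\<And>t. t \<ge> 0 \<Longrightarrow> c \<le> q (x + t *\<^sub>R y) - t * q y" for c x
      unfolding h_def by (rule cINF_greatest) (use that in auto)
    have "sublinear h"
    proof (rule sublinearI)
      fix u v
      have "h (u + v) \<le> (q (u + s *\<^sub>R y) - s * q y) + (q (v + t *\<^sub>R y) - t * q y)"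
        if "s \<ge> 0" "t \<ge> 0" for s t
      proof -
        have "h (u + v) \<le> q ((u + v) + (s + t) *\<^sub>R y) - (s + t) * q y"
          using that by (intro lower) simp
        also have "(u + v) + (s + t) *\<^sub>R y = (u + s *\<^sub>R y) + (v + t *\<^sub>R y)"
          by (simp add: algebra_simps)
        finally show ?thesis
          using sublinear_add[OF q, of "u + s *\<^sub>R y" "v + t *\<^sub>R y"] by (simp add: algebra_simps)
      qed
      then have "h (u + v) - (q (v + t *\<^sub>R y) - t * q y) \<le> h u" if "t \<ge> 0" for t
        using that by (intro great) (smt (verit))
      then have "h (u + v) - h u \<le> h v"
        by (intro great) (smt (verit))
      then show "h (u + v) \<le> h u + h v" by simp
    next
      fix t :: real and x assume t: "t > 0"
      have "h (t *\<^sub>R x) / t \<le> h x"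
      proof (rule great)
        fix s :: real assume s: "s \<ge> 0"
        have "h (t *\<^sub>R x) \<le> q (t *\<^sub>R x + (t * s) *\<^sub>R y) - (t * s) * q y"
          using s t by (intro lower) simp
        also have "t *\<^sub>R x + (t * s) *\<^sub>R y = t *\<^sub>R (x + s *\<^sub>R y)"
          by (simp add: algebra_simps)
        finally show "h (t *\<^sub>R x) / t \<le> q (x + s *\<^sub>R y) - s * q y"
          using t sublinear_scaleR[OF q, of t "x + s *\<^sub>R y"] by (simp add: field_simps)
      qed
      then show "h (t *\<^sub>R x) \<le> t * h x" using t by (simp add: field_simps)
    next
      show "h 0 = 0"
        using sublinear_scaleR[OF q] by (simp add: h_def)
    qed
    moreover have "h x \<le> q x" for x
      using lower[of 0 x] by simp
    ultimately have "h = q" by (rule min)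
    then have "q x \<le> q (x + y) - q y"
      using lower[of 1 x] by simp
    then show ?thesis using sublinear_add[OF q, of x y] by simp
  qed
  have neg: "q (- x) = - q x" for x
    using add[of x "- x"] sublinear_zero[OF q] by simp
  show ?thesis
  proof (rule linearI)
    fix c :: real and x
    show "q (c *\<^sub>R x) = c *\<^sub>R q x"
    proof (cases "c \<ge> 0")
      case False
      then have "q ((- c) *\<^sub>R x) = (- c) * q x" by (intro sublinear_scaleR[OF q]) simp
      then show ?thesis using neg[of "c *\<^sub>R x"] by simp
    qed (simp add: sublinear_scaleR[OF q])
  qed (rule add)
qed

theorem Hahn_Banach_sublinear:
  assumes "sublinear p"
  obtains f where "linear f" "\<And>x. f x \<le> p x"
  by (metis minimal_sublinear_exists[OF assms] minimal_sublinear_imp_linear)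

section \<open>The weak topology: closed convex sets and compactness\<close>

text \<open>
  Let \<open>d\<close> be the distance from \<open>x0\<close> to \<open>A\<close>. The functional
  \<open>p x = (INF (t, a). norm (x + t (a - x0)) - t d)\<close>, with \<open>t \<ge> 0\<close> and \<open>a \<in> A\<close>, is sublinear since \<open>A\<close>
  is convex, and finite since \<open>norm (a - x0) \<ge> d\<close>. A linear functional below \<open>p\<close> is bounded, by the
  terms with \<open>t = 0\<close>, and it separates, by the terms with \<open>t = 1\<close> at \<open>x = x0 - a\<close>. Thus one
  application of Hahn-Banach yields the strict separation without a gauge functional.
\<close>
lemma separation_point_closed_convex:
  fixes A :: "'a::real_normed_vector set"
  assumes A: "convex A" "closed A" and x0: "x0 \<notin> A"
  obtains \<phi> :: "'a \<Rightarrow>\<^sub>L real" and d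
  where "d > 0" "\<And>a. a \<in> A \<Longrightarrow> blinfun_apply \<phi> x0 + d \<le> blinfun_apply \<phi> a"
proof (cases "A = {}")
  case True
  \<comment> \<open>The zero functional separates from the empty set, with an arbitrary gap.\<close>
  then show ?thesis using that[of 1 0] by simp
next
  case False
  define d where "d = infdist x0 A"
  have d: "d > 0"
    unfolding d_def using A False x0 by (intro infdist_pos_not_in_closed)
  have dist: "d \<le> norm (a - x0)" if "a \<in> A" for a
    using infdist_le[OF that, of x0] by (simp add: d_def dist_norm norm_minus_commute)
  let ?S = "{0..} \<times> A"
  define g where "g x = (\<lambda>(t, a). norm (x + t *\<^sub>R (a - x0)) - t * d)" for x
  define p where "p x = (INF s\<in>?S. g x s)" for x
  have g_ge: "- norm x \<le> g x (t, a)" if "t \<ge> 0" "a \<in> A" for x t a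
  proof -
    have "t * d \<le> norm (t *\<^sub>R (a - x0))"
      using dist[OF that(2)] that(1) by (simp add: mult_left_mono)
    also have "\<dots> \<le> norm (x + t *\<^sub>R (a - x0)) + norm x"
      using norm_triangle_ineq4[of "x + t *\<^sub>R (a - x0)" x] by simp
    finally show ?thesis by (simp add: g_def)
  qed
  have lower: "p x \<le> g x (t, a)" if "t \<ge> 0" "a \<in> A" for x t a
    unfolding p_def
  proof (rule cINF_lower)
    show "bdd_below (g x ` ?S)"
      by (rule bdd_belowI2[where m = "- norm x"]) (use g_ge in auto)
  qed (use that in auto)
  have great: "c \<le> p x" if "\<And>t a. t \<ge> 0 \<Longrightarrow> a \<in> A \<Longrightarrow> c \<le> g x (t, a)" for c x
    unfolding p_def by (rule cINF_greatest) (use that False in auto)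
  obtain a0 where a0: "a0 \<in> A" using False by blast
  have p_norm: "p x \<le> norm x" for x
    using lower[of 0 a0 x] a0 by (simp add: g_def)
  have "sublinear p"
  proof (rule sublinearI)
    fix u v
    have *: "p (u + v) \<le> g u (s, a) + g v (t, b)" if st: "s \<ge> 0" "t \<ge> 0" and ab: "a \<in> A" "b \<in> A"
      for s t a b
    proof (cases "s + t = 0")
      case True
      then have "s = 0" "t = 0" using st by auto
      then show ?thesis
        using p_norm[of "u + v"] norm_triangle_ineq[of u v] by (simp add: g_def)
    next
      case False
      then have pos: "s + t > 0" using st by simp
      \<comment> \<open>The pairs \<open>(s, a)\<close> and \<open>(t, b)\<close> combine to the pair of weight \<open>s + t\<close> at their weighted mean.\<close>
      define c where "c = (s / (s + t)) *\<^sub>R a + (t / (s + t)) *\<^sub>R b"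
      have c: "c \<in> A"
        unfolding c_def using st pos ab by (intro convexD[OF A(1)]) (auto simp flip: add_divide_distrib)
      have "(s + t) *\<^sub>R c = s *\<^sub>R a + t *\<^sub>R b"
        using pos by (simp add: c_def scaleR_add_right)
      then have eq: "(u + v) + (s + t) *\<^sub>R (c - x0)
          = (u + s *\<^sub>R (a - x0)) + (v + t *\<^sub>R (b - x0))"
        by (simp add: algebra_simps)
      have "p (u + v) \<le> g (u + v) (s + t, c)"
        using pos c by (intro lower) auto
      then show ?thesis
        using norm_triangle_ineq[of "u + s *\<^sub>R (a - x0)" "v + t *\<^sub>R (b - x0)"]
        unfolding g_def prod.case eq by (simp add: algebra_simps)
    qed
    have "p (u + v) - g v (t, b) \<le> p u" if "t \<ge> 0" "b \<in> A" for t b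
      using * that by (intro great) (simp add: algebra_simps)
    then have "p (u + v) - p u \<le> p v"
      by (intro great) (simp add: algebra_simps)
    then show "p (u + v) \<le> p u + p v" by simp
  next
    fix t :: real and x assume t: "t > 0"
    have "p (t *\<^sub>R x) / t \<le> p x"
    proof (rule great)
      fix s :: real and a assume s: "s \<ge> 0" "a \<in> A"
      have "p (t *\<^sub>R x) \<le> g (t *\<^sub>R x) (t * s, a)"
        using s t by (intro lower) auto
      also have "\<dots> = norm (t *\<^sub>R (x + s *\<^sub>R (a - x0))) - t * (s * d)"
        by (simp add: g_def scaleR_add_right)
      also have "\<dots> = t * g x (s, a)"
        using t by (simp add: g_def right_diff_distrib)
      finally show "p (t *\<^sub>R x) / t \<le> g x (s, a)" using t by (simp add: field_simps)
    qed
    then show "p (t *\<^sub>R x) \<le> t * p x" using t by (simp add: field_simps)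
  next
    have "0 \<le> p 0" using g_ge[of _ _ 0] by (intro great) simp
    then show "p 0 = 0" using p_norm[of 0] by simp
  qed
  then obtain f where f: "linear f" "\<And>x. f x \<le> p x"
    using Hahn_Banach_sublinear by blast
  have "\<bar>f x\<bar> \<le> norm x" for x
    using f(2)[of x] f(2)[of "- x"] p_norm[of x] p_norm[of "- x"] linear_neg[OF f(1), of x] by simp
  then have "bounded_linear f"
    using f(1) by (intro bounded_linear_intro[where K = 1]) (auto simp: linear_add linear_scale)
  then have app: "blinfun_apply (Blinfun f) = f"
    by (rule bounded_linear_Blinfun_apply)
  show ?thesis
  proof (rule that[OF d, of "Blinfun f"], unfold app)
    fix a assume a: "a \<in> A"
    have "f (x0 - a) \<le> p (x0 - a)" by (rule f(2))
    also have "\<dots> \<le> g (x0 - a) (1, a)" using a by (intro lower) auto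
    also have "\<dots> = - d" by (simp add: g_def)
    finally show "f x0 + d \<le> f a" using linear_diff[OF f(1), of x0 a] by simp
  qed
qed

lemma openin_weak_vimage:
  fixes \<phi> :: "'a::real_normed_vector \<Rightarrow>\<^sub>L real"
  shows "open U \<Longrightarrow> openin weak_topology (blinfun_apply \<phi> -` U)"
  unfolding weak_topology_def
  by (rule topology_generated_by_Basis, rule CollectI, rule exI[of _ \<phi>], rule exI[of _ U]) simp

text \<open>
  The weak topology is the pullback of the topology of pointwise convergence on the dual along the
  evaluation map, so compactness can be taken from a product of intervals.
\<close>
lemma openin_weak_iff:
  "openin (weak_topology :: 'a::real_normed_vector topology) U \<longleftrightarrow>
    (\<exists>V. open V \<and> U = (\<lambda>(x::'a) (\<phi>::'a \<Rightarrow>\<^sub>L real). blinfun_apply \<phi> x) -` V)"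
proof
  let ?e = "\<lambda>(x::'a) (\<phi>::'a \<Rightarrow>\<^sub>L real). blinfun_apply \<phi> x"
  assume "openin (weak_topology :: 'a topology) U"
  then have "generate_topology_on {blinfun_apply \<phi> -` U | (\<phi> :: 'a \<Rightarrow>\<^sub>L real) U. open U} U"
    unfolding weak_topology_def by (rule openin_topology_generated_by)
  then show "\<exists>V. open V \<and> U = ?e -` V"
  proof induction
    case Empty
    show ?case by (rule exI[of _ "{}"]) simp
  next
    case (Int a b)
    then obtain V W where "open V" "open W" "a = ?e -` V"
      "b = ?e -` W" by blast
    then show ?case by (intro exI[of _ "V \<inter> W"]) (simp add: open_Int vimage_Int)
  next
    case (UN \<K>)
    then have "\<forall>k\<in>\<K>. \<exists>V. open V \<and> ?e -` V = k" by blast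
    from bchoice[OF this] obtain V where
      "\<forall>k\<in>\<K>. open (V k) \<and> ?e -` V k = k" by blast
    then show ?case
      by (intro exI[of _ "\<Union>k\<in>\<K>. V k"] conjI open_UN) (simp_all add: vimage_UN)
  next
    case (Basis s)
    then obtain \<phi> :: "'a \<Rightarrow>\<^sub>L real" and W where "open W" "s = blinfun_apply \<phi> -` W" by blast
    moreover have "open ((\<lambda>g :: ('a \<Rightarrow>\<^sub>L real) \<Rightarrow> real. g \<phi>) -` W)" if "open W"
      using that by (intro open_vimage) auto
    ultimately show ?case by (intro exI[of _ "(\<lambda>g. g \<phi>) -` W"]) auto
  qed
next
  let ?e = "\<lambda>(x::'a) (\<phi>::'a \<Rightarrow>\<^sub>L real). blinfun_apply \<phi> x"
  assume "\<exists>V. open V \<and> U = ?e -` V"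
  then obtain V where V: "open V" "U = ?e -` V" by blast
  have "continuous_map weak_topology (product_topology (\<lambda>_. euclidean) UNIV)
      (\<lambda>(x :: 'a) (\<phi> :: 'a \<Rightarrow>\<^sub>L real). blinfun_apply \<phi> x)"
    by (rule continuous_map_coordinatewise_then_product)
      (auto simp: continuous_map_def vimage_def[symmetric] intro: openin_weak_vimage)
  then show "openin weak_topology U"
    using V by (simp add: continuous_map_def euclidean_product_topology vimage_def)
qed

lemma openin_weak_imp_open:
  assumes "openin (weak_topology :: 'a::real_normed_vector topology) U"
  shows "open U"
proof -
  obtain V where V: "open V" "U = (\<lambda>(x::'a) (\<phi>::'a \<Rightarrow>\<^sub>L real). blinfun_apply \<phi> x) -` V"
    using assms openin_weak_iff by blast
  have "continuous_on UNIV (\<lambda>(x :: 'a) (\<phi> :: 'a \<Rightarrow>\<^sub>L real). blinfun_apply \<phi> x)"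
    by (intro continuous_on_coordinatewise_then_product continuous_intros)
  with V show ?thesis by (simp add: open_vimage)
qed

lemma closedin_weak_imp_closed: "closedin weak_topology A \<Longrightarrow> closed A"
  by (auto simp: closedin_def closed_def Compl_eq_Diff_UNIV dest: openin_weak_imp_open)

text \<open>
  Separation puts each point outside \<open>A\<close> into an open half-space, which is weakly open, that misses
  \<open>A\<close>.
\<close>
lemma closedin_weak_convex:
  fixes A :: "'a::real_normed_vector set"
  assumes "convex A" "closed A"
  shows "closedin weak_topology A"
  unfolding closedin_def
proof (intro conjI)
  show "openin weak_topology (topspace weak_topology - A)"
  proof (subst openin_subopen, intro ballI)
    fix x assume "x \<in> topspace weak_topology - A"
    then have "x \<notin> A" by simp
    then obtain \<phi> :: "'a \<Rightarrow>\<^sub>L real" and d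
      where d: "d > 0" "\<And>a. a \<in> A \<Longrightarrow> blinfun_apply \<phi> x + d \<le> blinfun_apply \<phi> a"
      using separation_point_closed_convex[OF assms] by blast
    show "\<exists>T. openin weak_topology T \<and> x \<in> T \<and> T \<subseteq> topspace weak_topology - A"
    proof (intro exI conjI)
      show "openin weak_topology (blinfun_apply \<phi> -` {..<blinfun_apply \<phi> x + d})"
        by (rule openin_weak_vimage) simp
    qed (use d in force)+
  qed
qed simp

text \<open>
  The functions \<open>g\<close> on the dual with \<open>\<bar>g \<phi>\<bar> \<le> R * norm \<phi>\<close> form a product of compact intervals, and
  the linear ones among them a closed, hence compact, subset \<open>L\<close>. By reflexivity each member of
  \<open>L\<close> is the evaluation at a point, so the preimage of \<open>L\<close> under the evaluation map is weakly
  compact, and it contains the ball.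
\<close>
lemma reflexive_bounded_weakly_compact:
  fixes R :: real
  assumes "reflexive_space TYPE('a::real_normed_vector)"
  shows "\<exists>S. compactin (weak_topology :: 'a topology) S \<and> cball 0 R \<subseteq> S"
proof -
  define e where "e = (\<lambda>(x::'a) (\<phi>::'a \<Rightarrow>\<^sub>L real). blinfun_apply \<phi> x)"
  define B where "B = PiE UNIV (\<lambda>\<phi> :: 'a \<Rightarrow>\<^sub>L real. {- (R * norm \<phi>)..R * norm \<phi>})"
  define L where "L = B \<inter> {g. linear g}"
  have "compactin (product_topology (\<lambda>_. euclidean) UNIV) B"
    unfolding B_def compactin_PiE by simp
  then have "compact B" by (simp add: euclidean_product_topology)
  moreover have "closed {g :: ('a \<Rightarrow>\<^sub>L real) \<Rightarrow> real. linear g}"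
  proof -
    have "{g :: ('a \<Rightarrow>\<^sub>L real) \<Rightarrow> real. linear g} =
        (\<Inter>\<phi> \<psi>. {g. g (\<phi> + \<psi>) = g \<phi> + g \<psi>}) \<inter> (\<Inter>c \<phi>. {g. g (c *\<^sub>R \<phi>) = c * g \<phi>})"
      by (auto simp: linear_iff)
    also have "closed \<dots>"
      by (intro closed_Int closed_INT ballI closed_Collect_eq continuous_intros
          continuous_on_product_coordinates)
    finally show ?thesis .
  qed
  ultimately have "compact L" unfolding L_def by (rule compact_Int_closed)
  have L_range: "L \<subseteq> range e"
  proof
    fix g assume g: "g \<in> L"
    have bound: "\<bar>g \<phi>\<bar> \<le> norm \<phi> * R" for \<phi>
    proof -
      have "g \<phi> \<in> {- (R * norm \<phi>)..R * norm \<phi>}" using g unfolding L_def B_def by (blast dest: PiE_mem)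
      then show ?thesis by (auto simp: abs_le_iff mult.commute)
    qed
    have "linear g" using g by (simp add: L_def)
    then have "bounded_linear g"
      using bound by (intro bounded_linear_intro[where K = R]) (auto simp: linear_add linear_scale)
    then have app: "blinfun_apply (Blinfun g) = g" by (rule bounded_linear_Blinfun_apply)
    obtain x where "Blinfun g = bidual_embedding (x::'a)"
      using assms unfolding reflexive_space_def by (meson surjD)
    then have "g = e x"
      using app by (auto simp: e_def bidual_embedding_apply fun_eq_iff)
    then show "g \<in> range e" by blast
  qed
  have "compactin weak_topology (e -` L)"
    unfolding compactin_def
  proof (intro conjI allI impI)
    fix \<U> assume \<U>: "Ball \<U> (openin weak_topology) \<and> e -` L \<subseteq> \<Union>\<U>"
    have "\<exists>V. open V \<and> e -` V = U" if "U \<in> \<U>" for U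
    proof -
      have "openin weak_topology U" using \<U> that by simp
      from iffD1[OF openin_weak_iff this] show ?thesis unfolding e_def by metis
    qed
    then have "\<forall>U\<in>\<U>. \<exists>V. open V \<and> e -` V = U" by simp
    from bchoice[OF this] obtain V where V: "\<forall>U\<in>\<U>. open (V U) \<and> e -` V U = U" by blast
    have "L \<subseteq> (\<Union>U\<in>\<U>. V U)"
    proof
      fix g assume "g \<in> L"
      then obtain x where x: "g = e x" using L_range by blast
      then obtain U where U: "U \<in> \<U>" "x \<in> U" using \<U> \<open>g \<in> L\<close> by blast
      then have "x \<in> e -` V U" using V by simp
      then show "g \<in> (\<Union>U\<in>\<U>. V U)" using U x by blast
    qed
    then obtain \<F> where \<F>: "\<F> \<subseteq> \<U>" "finite \<F>" "L \<subseteq> (\<Union>U\<in>\<F>. V U)"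
      using compactE_image[OF \<open>compact L\<close>, of \<U> V] V by blast
    have "e -` L \<subseteq> (\<Union>U\<in>\<F>. e -` V U)" using \<F>(3) by blast
    also have "\<dots> = \<Union>\<F>" using V \<F>(1) by (simp add: subset_iff cong: SUP_cong_simp)
    finally show "\<exists>\<F>. finite \<F> \<and> \<F> \<subseteq> \<U> \<and> e -` L \<subseteq> \<Union>\<F>"
      using \<F> by blast
  qed simp
  moreover have "cball 0 R \<subseteq> e -` L"
  proof
    fix x :: 'a assume x: "x \<in> cball 0 R"
    have "\<bar>e x \<phi>\<bar> \<le> R * norm \<phi>" for \<phi>
    proof -
      have "\<bar>e x \<phi>\<bar> \<le> norm \<phi> * norm x"
        unfolding e_def using norm_blinfun[of \<phi> x] by simp
      also have "\<dots> \<le> R * norm \<phi>"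
        using x mult_right_mono[of "norm x" R "norm \<phi>"] by (simp add: mult.commute)
      finally show ?thesis .
    qed
    then have "e x \<in> B" by (auto simp: B_def abs_le_iff minus_le_iff)
    moreover have "linear (e x)"
      by (rule linearI) (simp_all add: e_def plus_blinfun.rep_eq scaleR_blinfun.rep_eq)
    ultimately show "x \<in> e -` L" by (simp add: L_def)
  qed
  ultimately show ?thesis by blast
qed

lemma weakly_compact_closed_convex_bounded:
  fixes A :: "'a::real_normed_vector set"
  assumes "reflexive_space TYPE('a)" "convex A" "closed A" "A \<subseteq> cball 0 R"
  shows "compactin weak_topology A"
  by (metis assms closed_compactin closedin_weak_convex order_trans reflexive_bounded_weakly_compact)

section \<open>Brouwer and Knaster-Kuratowski-Mazurkiewicz\<close>

lemma tendsto_fun_componentwise: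
  fixes u :: "'b \<Rightarrow> 'i \<Rightarrow> 'c::topological_space"
  assumes "\<And>i. ((\<lambda>k. u k i) \<longlongrightarrow> l i) F"
  shows "(u \<longlongrightarrow> l) F"
proof -
  have "limitin (product_topology (\<lambda>_. euclidean) UNIV) u l F"
    unfolding limitin_componentwise using assms by simp
  then show ?thesis by (simp add: euclidean_product_topology)
qed

text \<open>
  The coordinates from \<open>n\<close> on are set to zero, which makes the cube compact as a set of functions
  on all natural numbers.
\<close>
definition unit_cube :: "nat \<Rightarrow> (nat \<Rightarrow> real) set" where
  "unit_cube n = {u. (\<forall>i<n. 0 \<le> u i \<and> u i \<le> 1) \<and> (\<forall>i\<ge>n. u i = 0)}"

lemma compact_unit_cube: "compact (unit_cube n)"
proof -
  have "unit_cube n = PiE UNIV (\<lambda>i. if i < n then {0..1} else {0})"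
    by (simp add: unit_cube_def set_eq_iff PiE_UNIV_domain Pi_iff if_split_mem2
        all_conj_distrib not_less)
  moreover have "compactin (product_topology (\<lambda>_. euclidean) UNIV) \<dots>"
    unfolding compactin_PiE by simp
  ultimately show ?thesis by (simp add: euclidean_product_topology)
qed

text \<open>
  Kuhn's lemma, applied to the grid of mesh \<open>1 / p\<close> with labels that tell in which direction \<open>f\<close>
  moves a coordinate, yields a small cell in which, for each coordinate \<open>i\<close>, the difference
  \<open>f x i - x i\<close> is nonnegative at a vertex \<open>r i\<close> and nonpositive at a vertex \<open>s i\<close>.
\<close>
lemma Brouwer_unit_cube_approximate:
  fixes f :: "(nat \<Rightarrow> real) \<Rightarrow> nat \<Rightarrow> real" and n p :: nat
  assumes p: "p > 0"
    and into: "\<And>u i. u \<in> unit_cube n \<Longrightarrow> i < n \<Longrightarrow> 0 \<le> f u i \<and> f u i \<le> 1"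
  obtains u r s where "u \<in> unit_cube n"
    "\<And>i. i < n \<Longrightarrow> r i \<in> unit_cube n \<and> s i \<in> unit_cube n"
    "\<And>i j. i < n \<Longrightarrow> \<bar>r i j - u j\<bar> \<le> 1 / p \<and> \<bar>s i j - u j\<bar> \<le> 1 / p"
    "\<And>i. i < n \<Longrightarrow> r i i \<le> f (r i) i \<and> f (s i) i \<le> s i i"
proof -
  define \<iota> where "\<iota> x = (\<lambda>i. if i < n then real (x i) / p else 0)" for x :: "nat \<Rightarrow> nat"
  have \<iota>: "\<iota> x \<in> unit_cube n" if "\<forall>i<n. x i \<le> p" for x
    using that p by (auto simp: unit_cube_def \<iota>_def)
  \<comment> \<open>Kuhn's lemma prescribes the label on the two faces orthogonal to a coordinate, so the label is
       forced there; since \<open>f\<close> maps into the cube, the forced value still has the right meaning.\<close>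
  define label where
    "label x i = (if x i = 0 \<or> (x i \<noteq> p \<and> \<iota> x i \<le> f (\<iota> x) i) then 0 else 1::nat)" for x i
  have label_0: "\<iota> x i \<le> f (\<iota> x) i" if "\<forall>i<n. x i \<le> p" "i < n" "label x i = 0" for x i
    using that into[OF \<iota>[OF that(1)] that(2)] by (auto simp: label_def \<iota>_def split: if_splits)
  have label_1: "f (\<iota> x) i \<le> \<iota> x i" if "\<forall>i<n. x i \<le> p" "i < n" "label x i = 1" for x i
    using that p into[OF \<iota>[OF that(1)] that(2)] by (auto simp: label_def \<iota>_def split: if_splits)
  obtain q where q: "\<forall>i<n. q i < p"
    and cell: "\<forall>i<n. \<exists>r s. (\<forall>j<n. q j \<le> r j \<and> r j \<le> q j + 1)
      \<and> (\<forall>j<n. q j \<le> s j \<and> s j \<le> q j + 1) \<and> label r i \<noteq> label s i"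
    by (rule kuhn_lemma[OF p, of n label]) (use p in \<open>auto simp: label_def\<close>)
  have "\<exists>r s. r \<in> unit_cube n \<and> s \<in> unit_cube n \<and>
      (\<forall>j. \<bar>r j - \<iota> q j\<bar> \<le> 1 / p \<and> \<bar>s j - \<iota> q j\<bar> \<le> 1 / p) \<and> r i \<le> f r i \<and> f s i \<le> s i"
    if i: "i < n" for i
  proof -
    from cell i obtain r s where r: "\<forall>j<n. q j \<le> r j \<and> r j \<le> q j + 1"
      and s: "\<forall>j<n. q j \<le> s j \<and> s j \<le> q j + 1" and rs: "label r i \<noteq> label s i"
      by blast
    have grid: "\<forall>j<n. x j \<le> p" if "\<forall>j<n. q j \<le> x j \<and> x j \<le> q j + 1" for x
      using that q by fastforce
    have near: "\<bar>\<iota> x j - \<iota> q j\<bar> \<le> 1 / p" if "\<forall>j<n. q j \<le> x j \<and> x j \<le> q j + 1" for x j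
    proof (cases "j < n")
      case True
      then have "real (q j) \<le> real (x j)" "real (x j) \<le> real (q j) + 1"
        using that by force+
      then have "0 \<le> (real (x j) - real (q j)) / p" "(real (x j) - real (q j)) / p \<le> 1 / p"
        using p by (intro divide_nonneg_pos divide_right_mono; simp)+
      then show ?thesis using True by (simp add: \<iota>_def diff_divide_distrib)
    qed (simp add: \<iota>_def)
    have "(label r i = 0 \<and> label s i = 1) \<or> (label s i = 0 \<and> label r i = 1)"
      using rs by (auto simp: label_def split: if_splits)
    then show ?thesis
      using label_0[OF grid[OF r] i] label_1[OF grid[OF s] i]
        label_0[OF grid[OF s] i] label_1[OF grid[OF r] i]
        \<iota>[OF grid[OF r]] \<iota>[OF grid[OF s]] near[OF r] near[OF s] by blast
  qed
  then obtain r s where rs: "r i \<in> unit_cube n \<and> s i \<in> unit_cube n \<and>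
      (\<forall>j. \<bar>r i j - \<iota> q j\<bar> \<le> 1 / p \<and> \<bar>s i j - \<iota> q j\<bar> \<le> 1 / p) \<and>
      r i i \<le> f (r i) i \<and> f (s i) i \<le> s i i" if "i < n" for i
    by metis
  have "\<iota> q \<in> unit_cube n" using q by (intro \<iota>) auto
  then show ?thesis by (rule that[of "\<iota> q" r s]) (use rs in \<open>simp_all only: simp_thms\<close>)
qed

text \<open>
  The cells for the meshes \<open>1 / (k + 1)\<close> shrink to a point \<open>v\<close> along a subsequence, by compactness.
  The two vertices for coordinate \<open>i\<close> converge to \<open>v\<close> as well, and in the limit they force
  \<open>f v i \<ge> v i\<close> and \<open>f v i \<le> v i\<close>.
\<close>
theorem Brouwer_unit_cube:
  fixes f :: "(nat \<Rightarrow> real) \<Rightarrow> nat \<Rightarrow> real"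
  assumes cont: "\<And>i. i < n \<Longrightarrow> continuous_on (unit_cube n) (\<lambda>u. f u i)"
    and into: "\<And>u i. u \<in> unit_cube n \<Longrightarrow> i < n \<Longrightarrow> 0 \<le> f u i \<and> f u i \<le> 1"
  obtains u where "u \<in> unit_cube n" "\<And>i. i < n \<Longrightarrow> f u i = u i"
proof -
  have "\<exists>u r s. u \<in> unit_cube n \<and>
      (\<forall>i<n. r i \<in> unit_cube n \<and> s i \<in> unit_cube n \<and>
        (\<forall>j. \<bar>r i j - u j\<bar> \<le> 1 / Suc k \<and> \<bar>s i j - u j\<bar> \<le> 1 / Suc k) \<and>
        r i i \<le> f (r i) i \<and> f (s i) i \<le> s i i)" for k
  proof (rule Brouwer_unit_cube_approximate[of "Suc k" n f, OF zero_less_Suc into])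
    fix u r s
    assume *: "u \<in> unit_cube n"
      "\<And>i. i < n \<Longrightarrow> r i \<in> unit_cube n \<and> s i \<in> unit_cube n"
      "\<And>i j. i < n \<Longrightarrow> \<bar>r i j - u j\<bar> \<le> 1 / Suc k \<and> \<bar>s i j - u j\<bar> \<le> 1 / Suc k"
      "\<And>i. i < n \<Longrightarrow> r i i \<le> f (r i) i \<and> f (s i) i \<le> s i i"
    show ?thesis
      by (rule exI[of _ u], rule exI[of _ r], rule exI[of _ s]) (simp add: * del: of_nat_Suc)
  qed
  then obtain u r s where u: "\<And>k. u k \<in> unit_cube n"
    and rs: "\<And>k i. i < n \<Longrightarrow> r k i \<in> unit_cube n \<and> s k i \<in> unit_cube n"
    and near: "\<And>k i j. i < n \<Longrightarrow> \<bar>r k i j - u k j\<bar> \<le> 1 / Suc k \<and> \<bar>s k i j - u k j\<bar> \<le> 1 / Suc k"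
    and sign: "\<And>k i. i < n \<Longrightarrow> r k i i \<le> f (r k i) i \<and> f (s k i) i \<le> s k i i"
    by metis
  have "seq_compact (unit_cube n)"
    using compact_unit_cube compact_eq_seq_compact_metric by blast
  then obtain v \<sigma> where v: "v \<in> unit_cube n" and \<sigma>: "strict_mono (\<sigma> :: nat \<Rightarrow> nat)"
    and lim: "(u \<circ> \<sigma>) \<longlonglongrightarrow> v"
    using u by (metis seq_compactE)
  have small: "(\<lambda>k. 1 / real (Suc (\<sigma> k))) \<longlonglongrightarrow> 0"
    using LIMSEQ_subseq_LIMSEQ[OF LIMSEQ_Suc[OF lim_1_over_n[where 'a = real]] \<sigma>] by (simp add: o_def)
  have coord: "(\<lambda>k. w k j) \<longlonglongrightarrow> l j" if "w \<longlonglongrightarrow> l" for w :: "nat \<Rightarrow> nat \<Rightarrow> real" and l j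
    using continuous_on_tendsto_compose[OF continuous_on_product_coordinates[of j] that] by simp
  have close: "(\<lambda>k. w (\<sigma> k)) \<longlonglongrightarrow> v"
    if "\<And>k j. \<bar>w k j - u k j\<bar> \<le> 1 / Suc k" for w
  proof (rule tendsto_fun_componentwise)
    fix j
    have "(\<lambda>k. w (\<sigma> k) j - u (\<sigma> k) j) \<longlonglongrightarrow> 0"
      by (rule Lim_null_comparison[OF _ small]) (use that in auto)
    from tendsto_add[OF this coord[OF lim, of j]]
    show "(\<lambda>k. w (\<sigma> k) j) \<longlonglongrightarrow> v j" by (simp add: o_def)
  qed
  have "f v i = v i" if i: "i < n" for i
  proof (rule antisym)
    have f_lim: "(\<lambda>k. f (w k) i) \<longlonglongrightarrow> f v i" if "w \<longlonglongrightarrow> v" "\<And>k. w k \<in> unit_cube n" for w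
      using continuous_on_tendsto_compose[OF cont[OF i] that(1) v] that(2) by simp
    have r: "(\<lambda>k. r (\<sigma> k) i) \<longlonglongrightarrow> v" and s: "(\<lambda>k. s (\<sigma> k) i) \<longlonglongrightarrow> v"
      using near[OF i] by (intro close; simp)+
    show "v i \<le> f v i"
      using LIMSEQ_le[OF coord[OF r, of i] f_lim[OF r]] sign[OF i] rs[OF i] by blast
    show "f v i \<le> v i"
      using LIMSEQ_le[OF f_lim[OF s] coord[OF s, of i]] sign[OF i] rs[OF i] by blast
  qed
  with v show thesis by (rule that)
qed

text \<open>
  If the sets \<open>G y\<close> had no common point, the distances to them would have a positive sum at every
  point of the space, and dividing by that sum would give continuous weights. Mapping coefficients
  \<open>u\<close> to the weights at the combination \<open>\<xi> u\<close> sends the cube to itself, and a fixed point is a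
  convex combination \<open>\<xi> u\<close> of just those points \<open>y\<close> for which \<open>\<xi> u \<notin> G y\<close>, contrary to the
  covering of the hull. The weights are defined on the whole cube and always add up to one,
  so a fixed point in the cube automatically lies in the simplex.
\<close>
theorem KKM_finite:
  fixes G :: "'a::real_normed_vector \<Rightarrow> 'a set"
  assumes Y: "finite Y" "Y \<noteq> {}"
    and closed: "\<And>y. y \<in> Y \<Longrightarrow> closed (G y)"
    and KKM: "\<And>T. T \<subseteq> Y \<Longrightarrow> convex hull T \<subseteq> (\<Union>y\<in>T. G y)"
  shows "(\<Inter>y\<in>Y. G y) \<noteq> {}"
proof
  assume empty: "(\<Inter>y\<in>Y. G y) = {}"
  define n where "n = card Y"
  obtain y where y: "bij_betw y {..<n} Y"
    using ex_bij_betw_nat_finite[OF Y(1)] unfolding n_def atLeast0LessThan by blast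
  have y_in: "y i \<in> Y" if "i < n" for i using y that by (auto simp: bij_betw_def)
  have nonempty: "G z \<noteq> {}" if "z \<in> Y" for z
    using KKM[of "{z}"] that by auto
  define g where "g i x = infdist x (G (y i))" for i x
  have g_ge: "0 \<le> g i x" for i x by (simp add: g_def infdist_nonneg)
  have g_zero: "x \<in> G (y i) \<longleftrightarrow> g i x = 0" if "i < n" for i x
    unfolding g_def using y_in[OF that] closed nonempty by (intro in_closed_iff_infdist_zero) auto
  define S where "S x = (\<Sum>i<n. g i x)" for x
  have S_pos: "S x > 0" for x
  proof -
    have "x \<notin> (\<Inter>z\<in>Y. G z)" using empty by simp
    then obtain z where z: "z \<in> Y" "x \<notin> G z" by auto
    have "z \<in> y ` {..<n}" using y z(1) by (simp add: bij_betw_def)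
    then obtain i where "i < n" "g i x \<noteq> 0"
      using z(2) g_zero by auto
    then show ?thesis
      unfolding S_def using g_ge[of i x] by (intro sum_pos2[of _ i]) (auto simp: g_ge less_le)
  qed
  define \<xi> where "\<xi> u = (\<Sum>i<n. u i *\<^sub>R y i)" for u :: "nat \<Rightarrow> real"
  define f where "f u i = g i (\<xi> u) / S (\<xi> u)" for u i
  have coords: "continuous_on A (\<lambda>u :: nat \<Rightarrow> real. u i)" for A i
    by (rule continuous_on_subset[OF continuous_on_product_coordinates subset_UNIV])
  have \<xi>_cont: "continuous_on A \<xi>" for A
    unfolding \<xi>_def by (intro continuous_on_sum continuous_on_scaleR coords continuous_on_const)
  have g_cont: "continuous_on A (\<lambda>u. g i (\<xi> u))" for A i
    unfolding g_def by (intro continuous_on_infdist \<xi>_cont)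
  have "continuous_on (unit_cube n) (\<lambda>u. f u i)" for i
    unfolding f_def using S_pos unfolding S_def
    by (intro continuous_on_divide continuous_on_sum g_cont) (auto simp: less_le)
  moreover have "0 \<le> f u i \<and> f u i \<le> 1" if "i < n" for u i
    using S_pos[of "\<xi> u"] g_ge member_le_sum[of i "{..<n}" "\<lambda>i. g i (\<xi> u)"] that
    by (simp add: f_def S_def divide_le_eq)
  ultimately obtain u where u: "\<And>i. i < n \<Longrightarrow> f u i = u i"
    using Brouwer_unit_cube[of n f] by metis
  let ?I = "{i. i < n \<and> u i \<noteq> 0}"
  have u_ge: "u i \<ge> 0" if "i < n" for i
    using u[OF that] S_pos[of "\<xi> u"] g_ge[of i "\<xi> u"] by (metis divide_nonneg_pos f_def)
  have sum_u: "(\<Sum>i\<in>?I. u i) = 1"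
  proof -
    have "(\<Sum>i\<in>?I. u i) = (\<Sum>i<n. u i)" by (rule sum.mono_neutral_left) auto
    also have "\<dots> = (\<Sum>i<n. f u i)" using u by simp
    also have "\<dots> = 1" using S_pos[of "\<xi> u"] by (simp add: f_def S_def flip: sum_divide_distrib)
    finally show ?thesis .
  qed
  have "\<xi> u = (\<Sum>i\<in>?I. u i *\<^sub>R y i)"
    unfolding \<xi>_def by (rule sum.mono_neutral_right) auto
  also have "\<dots> \<in> convex hull (y ` ?I)"
    using sum_u u_ge by (intro convex_sum) (auto intro: hull_inc)
  finally have "\<xi> u \<in> convex hull (y ` ?I)" .
  moreover have "y ` ?I \<subseteq> Y" using y_in by auto
  ultimately obtain i where i: "i < n" "u i \<noteq> 0" "\<xi> u \<in> G (y i)"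
    using KKM by blast
  then have "f u i = 0" using g_zero by (simp add: f_def)
  with u i show False by simp
qed

text \<open>
  Weak compactness reduces a common point of all \<open>G y\<close> to finite subfamilies. For these the KKM
  principle for norm closed sets applies, as weakly closed sets are norm closed.
\<close>
lemma KKM_weakly_compact:
  fixes G :: "'a::real_normed_vector \<Rightarrow> 'a set"
  assumes M: "compactin weak_topology M" "M \<noteq> {}"
    and closed: "\<And>y. y \<in> M \<Longrightarrow> closedin weak_topology (G y)"
    and sub: "\<And>y. y \<in> M \<Longrightarrow> G y \<subseteq> M"
    and KKM: "\<And>T. finite T \<Longrightarrow> T \<subseteq> M \<Longrightarrow> convex hull T \<subseteq> (\<Union>y\<in>T. G y)"
  obtains x where "x \<in> M" "\<And>y. y \<in> M \<Longrightarrow> x \<in> G y"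
proof -
  have "M \<inter> \<Inter>(G ` M) \<noteq> {}"
    using M(1) unfolding compactin_fip
  proof (elim conjE allE[of _ "G ` M"], elim mp, intro conjI ballI allI impI)
    fix A assume "A \<in> G ` M"
    then show "closedin weak_topology A" using closed by blast
  next
    fix \<F> assume \<F>: "finite \<F> \<and> \<F> \<subseteq> G ` M"
    then obtain Y where Y: "finite Y" "Y \<subseteq> M" "\<F> = G ` Y"
      by (meson finite_subset_image)
    show "M \<inter> \<Inter>\<F> \<noteq> {}"
    proof (cases "Y = {}")
      case True
      then show ?thesis using M(2) Y by simp
    next
      case False
      have "(\<Inter>y\<in>Y. G y) \<noteq> {}"
      proof (rule KKM_finite[OF Y(1) False])
        fix y assume "y \<in> Y"
        then show "closed (G y)" using closed Y(2) by (intro closedin_weak_imp_closed) auto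
      next
        fix T assume "T \<subseteq> Y"
        then show "convex hull T \<subseteq> (\<Union>y\<in>T. G y)"
          using Y by (intro KKM) (auto intro: finite_subset)
      qed
      moreover have "(\<Inter>y\<in>Y. G y) \<subseteq> M" using False Y(2) sub by blast
      ultimately show ?thesis using Y(3) by blast
    qed
  qed
  then show thesis using that by blast
qed

section \<open>Cones with interior and convex vector-valued maps\<close>

text \<open>
  A translate of \<open>int C\<close> by an element of \<open>C\<close> is open and contained in \<open>C + C = C\<close>.
\<close>
lemma interior_cone_add:
  fixes C :: "'z::real_topological_vector_space set"
  assumes "C + C = C" and a: "a \<in> interior C" and c: "c \<in> C"
  shows "a + c \<in> interior C"
proof -
  let ?U = "(\<lambda>x. x - c) -` interior C"
  have "open ?U"
    by (rule open_vimage[OF open_interior]) (intro continuous_intros)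
  moreover have "?U \<subseteq> C"
  proof
    fix x assume "x \<in> ?U"
    then have "(x - c) + c \<in> C + C" using c interior_subset by (intro set_plus_intro) auto
    then show "x \<in> C" using assms(1) by simp
  qed
  ultimately show ?thesis using a by (intro interiorI[of ?U]) auto
qed

lemma interior_cone_scaleR:
  fixes C :: "'z::real_topological_vector_space set"
  assumes "cone C" and a: "a \<in> interior C" and t: "t > 0"
  shows "t *\<^sub>R a \<in> interior C"
proof -
  let ?U = "(\<lambda>x. inverse t *\<^sub>R x) -` interior C"
  have "((\<lambda>y. inverse t *\<^sub>R y) \<longlongrightarrow> inverse t *\<^sub>R x) (nhds x)" for x :: 'z
  proof -
    have "((\<lambda>y. (inverse t, y)) \<longlongrightarrow> (inverse t, x)) (nhds x)"
      by (intro tendsto_Pair tendsto_const filterlim_ident)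
    then have "LIM y nhds x. (inverse t, y) :> nhds (inverse t) \<times>\<^sub>F nhds x"
      by (simp add: nhds_prod)
    from filterlim_compose[OF tendsto_scaleR_Pair this] show ?thesis by simp
  qed
  then have "continuous_on UNIV (\<lambda>y :: 'z. inverse t *\<^sub>R y)"
    unfolding continuous_on_def using tendsto_mono at_within_le_nhds by blast
  then have "open ?U"
    by (rule open_vimage[OF open_interior])
  moreover have "?U \<subseteq> C"
  proof
    fix x assume "x \<in> ?U"
    then have "t *\<^sub>R (inverse t *\<^sub>R x) \<in> C"
      using mem_cone[OF assms(1), of "inverse t *\<^sub>R x" t] t interior_subset[of C] by auto
    then show "x \<in> C" using t by simp
  qed
  ultimately show ?thesis using a t by (intro interiorI[of ?U]) auto
qed

text \<open>
  In the order of the cone the open set \<open>- int C\<close> is closed under passing to smaller elements. The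
  closedness of the solution sets and the use of \<open>C\<close>-convexity both rest on this.
\<close>
lemma neg_interior_downward:
  fixes C :: "'z::real_topological_vector_space set"
  assumes "C + C = C" and "b \<in> uminus ` interior C" and "b - a \<in> C"
  shows "a \<in> uminus ` interior C"
proof -
  have "- b + (b - a) \<in> interior C"
    using assms by (intro interior_cone_add) auto
  then show ?thesis by (intro image_eqI[of _ _ "- a"]) auto
qed

lemma open_neg_interior: "open (uminus ` interior (C :: 'z::topological_group_add set))"
proof -
  have "uminus ` interior C = uminus -` interior C"
    by (auto intro: image_eqI[of _ _ "- _"])
  moreover have "open (uminus -` interior C)"
    by (intro open_vimage[OF open_interior] continuous_on_minus continuous_on_id)
  ultimately show ?thesis by simp
qed

lemma convex_neg_interior_sublevel:
  fixes C :: "'z::real_topological_vector_space set" and f :: "'x::real_vector \<Rightarrow> 'z"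
  assumes C: "cone C" "C + C = C" and K: "convex K" and f: "C_convex_on C K f"
  shows "convex {y \<in> K. f y \<in> uminus ` interior C}"
proof (rule convexI)
  fix x y and u v :: real
  assume x: "x \<in> {y \<in> K. f y \<in> uminus ` interior C}" and y: "y \<in> {y \<in> K. f y \<in> uminus ` interior C}"
    and uv: "0 \<le> u" "0 \<le> v" "u + v = 1"
  show "u *\<^sub>R x + v *\<^sub>R y \<in> {y \<in> K. f y \<in> uminus ` interior C}"
  proof (cases "u = 0")
    case True
    then show ?thesis using uv y by simp
  next
    case False
    then have u: "u > 0" using uv by simp
    have v: "v = 1 - u" using uv by simp
    obtain a where a: "a \<in> interior C" "f x = - a" using x by blast
    obtain b where b: "b \<in> interior C" "f y = - b" using y by blast
    have "u *\<^sub>R a + v *\<^sub>R b \<in> interior C"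
      using interior_cone_scaleR[OF C(1) a(1) u] mem_cone[OF C(1) _ uv(2), of b] b(1)
        interior_subset[of C] by (intro interior_cone_add[OF C(2)]) auto
    then have "u *\<^sub>R f x + v *\<^sub>R f y \<in> uminus ` interior C"
      using a b by (intro image_eqI[of _ _ "u *\<^sub>R a + v *\<^sub>R b"]) auto
    moreover have "u *\<^sub>R f x + v *\<^sub>R f y - f (u *\<^sub>R x + v *\<^sub>R y) \<in> C"
      using f x y uv unfolding C_convex_on_def v by auto
    ultimately have "f (u *\<^sub>R x + v *\<^sub>R y) \<in> uminus ` interior C"
      by (rule neg_interior_downward[OF C(2)])
    moreover have "u *\<^sub>R x + v *\<^sub>R y \<in> K" using convexD[OF K] x y uv by auto
    ultimately show ?thesis by simp
  qed
qed

section \<open>Weak closedness of the solution sets\<close>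

text \<open>
  A point \<open>x\<close> of the closure of \<open>S\<close> is the limit of the net \<open>(U, p) \<mapsto> p\<close> over the open
  neighbourhoods \<open>U\<close> of \<open>x\<close> with a point \<open>p \<in> U \<inter> S\<close>, ordered by reverse inclusion of the
  neighbourhoods. So nets with indices in \<open>'a net_index\<close> detect closedness.
\<close>
lemma closedin_if_net_closed:
  fixes T :: "'a topology"
  assumes K: "closedin T K" and sub: "S \<subseteq> K"
    and net: "\<And>(A :: 'a net_index set) r xs x. x \<in> K \<Longrightarrow> directed_on A r \<Longrightarrow> xs ` A \<subseteq> S \<Longrightarrow>
      limitin T xs x (tails A r) \<Longrightarrow> x \<in> S"
  shows "closedin T S"
proof -
  have "T closure_of S \<subseteq> S"
  proof
    fix x assume x: "x \<in> T closure_of S"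
    define A where "A = {(U, p). openin T U \<and> x \<in> U \<and> p \<in> U \<inter> S}"
    define r where "r = {(i, j). i \<in> A \<and> j \<in> A \<and> fst j \<subseteq> fst i}"
    have in_top: "x \<in> topspace T" and meets: "\<And>U. openin T U \<Longrightarrow> x \<in> U \<Longrightarrow> \<exists>p. p \<in> U \<inter> S"
      using x unfolding in_closure_of by blast+
    have directed: "directed_on A r"
      unfolding directed_on_def
    proof (intro conjI ballI)
      show "preorder_on A r"
        by (auto simp: preorder_on_def r_def refl_on_def trans_def)
      obtain p where "p \<in> topspace T \<inter> S" using meets[OF openin_topspace in_top] by blast
      then have "(topspace T, p) \<in> A" using in_top by (simp add: A_def)
      then show "A \<noteq> {}" by blast
    next
      fix i j assume ij: "i \<in> A" "j \<in> A"
      then have W: "openin T (fst i \<inter> fst j)" "x \<in> fst i \<inter> fst j"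
        by (auto simp: A_def)
      obtain p where "p \<in> (fst i \<inter> fst j) \<inter> S" using meets[OF W] by blast
      then have "(fst i \<inter> fst j, p) \<in> A" using W by (simp add: A_def)
      then show "\<exists>c\<in>A. (i, c) \<in> r \<and> (j, c) \<in> r"
        using ij by (intro bexI[of _ "(fst i \<inter> fst j, p)"]) (auto simp: r_def)
    qed
    have "limitin T snd x (tails A r)"
      unfolding limitin_def
    proof (intro conjI allI impI)
      fix U assume U: "openin T U \<and> x \<in> U"
      then obtain p where "p \<in> U \<inter> S" using meets by blast
      then have "(U, p) \<in> A" using U by (simp add: A_def)
      then show "\<forall>\<^sub>F i in tails A r. snd i \<in> U"
        unfolding eventually_tails[OF directed] by (intro bexI[of _ "(U, p)"]) (auto simp: r_def A_def)
    qed (rule in_top)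
    moreover have "snd ` A \<subseteq> S" by (auto simp: A_def)
    moreover have "x \<in> K"
      using x closure_of_minimal[OF sub K] by blast
    ultimately show "x \<in> S" using net directed by blast
  qed
  then show ?thesis
    using closure_of_subset_eq K sub closedin_subset by (metis order_trans)
qed

text \<open>
  If \<open>f x \<in> - int C\<close>, then upper semicontinuity for the neighbourhood \<open>- int C\<close> of \<open>f x\<close> keeps \<open>f\<close>
  near \<open>x\<close> in \<open>- int C - C\<close>, which is contained in \<open>- int C\<close>.
\<close>
lemma closedin_not_neg_interior_usc:
  fixes C :: "'z::real_topological_vector_space set"
  assumes CC: "C + C = C" and K: "closedin T K" and usc: "C_upper_semicontinuous_on T C K f"
  shows "closedin T {x \<in> K. f x \<notin> uminus ` interior C}"
  unfolding closedin_def
proof (intro conjI)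
  let ?N = "uminus ` interior C"
  show "{x \<in> K. f x \<notin> ?N} \<subseteq> topspace T" using closedin_subset[OF K] by auto
  show "openin T (topspace T - {x \<in> K. f x \<notin> ?N})"
  proof (subst openin_subopen, intro ballI)
    fix x assume x: "x \<in> topspace T - {x \<in> K. f x \<notin> ?N}"
    show "\<exists>W. openin T W \<and> x \<in> W \<and> W \<subseteq> topspace T - {x \<in> K. f x \<notin> ?N}"
    proof (cases "x \<in> K")
      case False
      then show ?thesis
        using x K by (intro exI[of _ "topspace T - K"]) auto
    next
      case True
      then have "f x \<in> ?N" using x by simp
      then have "\<exists>U. openin T U \<and> x \<in> U \<and>
          (\<forall>u\<in>U \<inter> K. f u \<in> {v - c | v c. v \<in> ?N \<and> c \<in> C})"
        using usc[unfolded C_upper_semicontinuous_on_def, rule_format, OF True, of ?N]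
          open_neg_interior[of C] by simp
      then obtain U where U: "openin T U" "x \<in> U"
        and fU: "\<forall>u\<in>U \<inter> K. f u \<in> {v - c | v c. v \<in> ?N \<and> c \<in> C}"
        by (elim exE conjE)
      have "f u \<in> ?N" if u: "u \<in> U \<inter> K" for u
      proof -
        obtain v c where vc: "f u = v - c" "v \<in> ?N" "c \<in> C" using bspec[OF fU u] by (elim CollectE exE conjE)
        show ?thesis by (rule neg_interior_downward[OF CC vc(2)]) (use vc in simp)
      qed
      then show ?thesis using U openin_subset[OF U(1)] by (intro exI[of _ U]) auto
    qed
  qed
qed

text \<open>
  The first alternative is closedness under nets and the second is
  \<open>closedin_not_neg_interior_usc\<close>. In the third,
  suppose that \<open>f x \<in> - int C\<close>. The limit \<open>z\<close> of the comparison net is below \<open>f x\<close>, so it lies in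
  this open set too; hence so do the \<open>zs \<alpha>\<close> from some index on, and with them the smaller values
  \<open>f (xs \<alpha>)\<close>.
\<close>
lemma weakly_closed_solution_set:
  fixes C :: "'z::real_topological_vector_space set" and f :: "'x::real_normed_vector \<Rightarrow> 'z"
  assumes CC: "C + C = C" and K: "closedin weak_topology K"
    and i: "(\<forall>(A :: 'x net_index set) r xs. \<forall>x\<in>K.
         directed_on A r \<and> xs ` A \<subseteq> K \<and> limitin weak_topology xs x (tails A r) \<and>
         (\<forall>\<alpha>\<in>A. f (xs \<alpha>) \<notin> uminus ` interior C)
         \<longrightarrow> f x \<notin> uminus ` interior C)
      \<or> C_upper_semicontinuous_on weak_topology C K f
      \<or> (\<forall>x\<in>K. \<forall>(A :: 'x net_index set) r xs.
           directed_on A r \<and> xs ` A \<subseteq> K \<and> limitin weak_topology xs x (tails A r)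
           \<longrightarrow> (\<exists>zs z. (zs \<longlongrightarrow> z) (tails A r) \<and>
                 (\<forall>\<alpha>\<in>A. f (xs \<alpha>) - zs \<alpha> \<in> uminus ` C) \<and> f x - z \<in> C))"
      (is "?a \<or> ?b \<or> ?c")
  shows "closedin weak_topology {x \<in> K. f x \<notin> uminus ` interior C}" (is "closedin _ ?S")
  using i
proof (elim disjE)
  assume a: ?a
  show ?thesis
  proof (rule closedin_if_net_closed[OF K])
    fix A :: "'x net_index set" and r xs x
    assume x: "x \<in> K" and net: "directed_on A r" "xs ` A \<subseteq> ?S" "limitin weak_topology xs x (tails A r)"
    have "xs ` A \<subseteq> K" "\<forall>\<alpha>\<in>A. f (xs \<alpha>) \<notin> uminus ` interior C" using net(2) by blast+
    then have "f x \<notin> uminus ` interior C" using a x net by blast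
    with x show "x \<in> ?S" by simp
  qed auto
next
  assume ?b
  then show ?thesis by (rule closedin_not_neg_interior_usc[OF CC K])
next
  assume c: ?c
  show ?thesis
  proof (rule closedin_if_net_closed[OF K])
    fix A :: "'x net_index set" and r xs x
    assume x: "x \<in> K" and net: "directed_on A r" "xs ` A \<subseteq> ?S" "limitin weak_topology xs x (tails A r)"
    have xs: "xs ` A \<subseteq> K" "\<forall>\<alpha>\<in>A. f (xs \<alpha>) \<notin> uminus ` interior C" using net(2) by blast+
    from c[rule_format, OF x conjI[OF net(1) conjI[OF xs(1) net(3)]]]
    obtain zs z where zs: "(zs \<longlongrightarrow> z) (tails A r)"
      and below: "\<forall>\<alpha>\<in>A. f (xs \<alpha>) - zs \<alpha> \<in> uminus ` C" and above: "f x - z \<in> C"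
      by (elim exE conjE)
    have "f x \<notin> uminus ` interior C"
    proof
      assume "f x \<in> uminus ` interior C"
      from neg_interior_downward[OF CC this above] have "z \<in> uminus ` interior C" .
      then have "\<forall>\<^sub>F \<alpha> in tails A r. zs \<alpha> \<in> uminus ` interior C"
        using topological_tendstoD[OF zs open_neg_interior] by blast
      then obtain a where a: "a \<in> A" "\<forall>b\<in>A. (a, b) \<in> r \<longrightarrow> zs b \<in> uminus ` interior C"
        unfolding eventually_tails[OF net(1)] by blast
      then obtain b where b: "b \<in> A" "(a, b) \<in> r"
        using net(1) unfolding directed_on_def by blast
      have "zs b - f (xs b) \<in> C"
      proof -
        obtain k where "k \<in> C" "f (xs b) - zs b = - k" using below b by blast
        then show ?thesis by (metis minus_diff_eq minus_minus)
      qed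
      with neg_interior_downward[OF CC] a(2) b have "f (xs b) \<in> uminus ` interior C" by blast
      with xs b show False by blast
    qed
    with x show "x \<in> ?S" by simp
  qed auto
qed

section \<open>Existence of a solution\<close>

theorem theorem4p1:
  fixes K :: "'x::banach set"
    and C :: "'z::{real_topological_vector_space, t2_space} set"
    and F :: "'x \<Rightarrow> 'x \<Rightarrow> 'x \<Rightarrow> 'z"
  assumes reflexive: "reflexive_space TYPE('x)"
    and C_cone: "cone C"
    and C_convex: "C + C = C"
    and C_pointed: "C \<inter> uminus ` C = {0}"
    and C_interior: "interior C \<noteq> {}"
    and K: "K \<noteq> {}" "convex K" "closed K"
    and i: "\<forall>y\<in>K.
      (\<forall>(A :: 'x net_index set) r xs. \<forall>x\<in>K.
         directed_on A r \<and> xs ` A \<subseteq> K \<and> limitin weak_topology xs x (tails A r) \<and>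
         (\<forall>\<alpha>\<in>A. F (xs \<alpha>) y (xs \<alpha>) \<notin> uminus ` interior C)
         \<longrightarrow> F x y x \<notin> uminus ` interior C)
      \<or> C_upper_semicontinuous_on weak_topology C K (\<lambda>x. F x y x)
      \<or> (\<forall>x\<in>K. \<forall>(A :: 'x net_index set) r xs.
           directed_on A r \<and> xs ` A \<subseteq> K \<and> limitin weak_topology xs x (tails A r)
           \<longrightarrow> (\<exists>zs z. (zs \<longlongrightarrow> z) (tails A r) \<and>
                 (\<forall>\<alpha>\<in>A. F (xs \<alpha>) y (xs \<alpha>) - zs \<alpha> \<in> uminus ` C) \<and> F x y x - z \<in> C))"
    and ii: "\<forall>x\<in>K. C_convex_on C K (\<lambda>y. F x y x)"
    and iii: "\<forall>x\<in>K. F x x x \<in> uminus ` C - uminus ` interior C"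
    and iv: "\<exists>r>0. \<forall>x\<in>K. norm x > r \<longrightarrow>
      (\<exists>y\<^sub>0\<in>K. norm y\<^sub>0 < norm x \<and> F x y\<^sub>0 x \<in> uminus ` C)"
  shows "\<exists>x\<^sub>0\<in>K. \<forall>y\<in>K. F x\<^sub>0 y x\<^sub>0 \<notin> uminus ` interior C"
proof -
  let ?N = "uminus ` interior C"
  obtain r where r: "\<forall>x\<in>K. norm x > r \<longrightarrow> (\<exists>y\<^sub>0\<in>K. norm y\<^sub>0 < norm x \<and> F x y\<^sub>0 x \<in> uminus ` C)"
    using iv by blast
  obtain k where k: "k \<in> K" using K(1) by blast
  \<comment> \<open>Exceeding \<open>r\<close> makes coercivity available on the sphere of radius \<open>R\<close>, and exceeding \<open>norm k\<close>
       makes the truncated set nonempty.\<close>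
  define R where "R = max r (norm k) + 1"
  define M where "M = K \<inter> cball 0 R"
  have M_convex: "convex M" unfolding M_def by (intro convex_Int K convex_cball)
  have M: "closed M" "M \<noteq> {}" "M \<subseteq> K"
    using k K(3) by (auto simp: M_def R_def intro: closed_Int)
  have M_compact: "compactin weak_topology M"
    by (rule weakly_compact_closed_convex_bounded[OF reflexive M_convex M(1), of R]) (simp add: M_def)
  define G where "G y = M \<inter> {x \<in> K. F x y x \<notin> ?N}" for y
  obtain x where x: "x \<in> M" and x_sol: "\<And>y. y \<in> M \<Longrightarrow> x \<in> G y"
  proof (rule KKM_weakly_compact[OF M_compact M(2), of G])
    fix y assume "y \<in> M"
    then have "y \<in> K" using M(3) by blast
    have "closedin weak_topology {x \<in> K. F x y x \<notin> ?N}"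
      by (rule weakly_closed_solution_set[OF C_convex closedin_weak_convex[OF K(2,3)]
            bspec[OF i \<open>y \<in> K\<close>]])
    then show "closedin weak_topology (G y)"
      unfolding G_def by (rule closedin_Int[OF closedin_weak_convex[OF M_convex M(1)]])
  next
    fix T assume T: "finite T" "T \<subseteq> M"
    show "convex hull T \<subseteq> (\<Union>y\<in>T. G y)"
    proof (rule subsetI, rule ccontr)
      fix x assume x: "x \<in> convex hull T" "x \<notin> (\<Union>y\<in>T. G y)"
      have xM: "x \<in> M" using x(1) hull_minimal[OF T(2), of convex] M_convex by blast
      then have xK: "x \<in> K" using M(3) by blast
      have "T \<subseteq> {y \<in> K. F x y x \<in> ?N}"
        using x(2) xM xK T(2) M(3) by (auto simp: G_def)
      then have "convex hull T \<subseteq> {y \<in> K. F x y x \<in> ?N}"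
        using ii xK by (intro hull_minimal convex_neg_interior_sublevel[OF C_cone C_convex K(2)]) auto
      then show False using x(1) iii xK by blast
    qed
  qed (auto simp: G_def)
  have xK: "x \<in> K" using x M(3) by blast
  obtain y0 where y0: "y0 \<in> K" "norm y0 < R" "F x y0 x \<in> uminus ` C"
  proof (cases "norm x < R")
    case True
    then show ?thesis using that[of x] xK iii by blast
  next
    case False
    then have "norm x = R" "norm x > r" using x by (auto simp: M_def R_def)
    then show ?thesis using r xK that by metis
  qed
  have "F x y x \<notin> ?N" if y: "y \<in> K" for y
  proof
    assume neg: "F x y x \<in> ?N"
    \<comment> \<open>Chosen so that \<open>norm w \<le> t * norm y + norm y0 \<le> R\<close>; the 1 avoids a zero denominator.\<close>
    define t where "t = min 1 ((R - norm y0) / (norm y + 1))"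
    have t: "0 < t" "t \<le> 1" using y0(2) by (auto simp: t_def add_nonneg_pos)
    define w where "w = t *\<^sub>R y + (1 - t) *\<^sub>R y0"
    have "w \<in> K" unfolding w_def using convexD[OF K(2)] y y0(1) t by simp
    moreover have "norm w \<le> R"
    proof -
      have "t * (norm y + 1) \<le> R - norm y0"
        using pos_le_divide_eq[of "norm y + 1" t "R - norm y0"] by (simp add: t_def add_nonneg_pos)
      moreover have "norm w \<le> t * norm y + (1 - t) * norm y0"
        unfolding w_def using t norm_triangle_ineq[of "t *\<^sub>R y" "(1 - t) *\<^sub>R y0"] by simp
      moreover have "(1 - t) * norm y0 \<le> norm y0"
        using t by (simp add: mult_left_le_one_le)
      ultimately show ?thesis using t by (simp add: distrib_left)
    qed
    ultimately have "w \<in> M" by (simp add: M_def)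
    then have w: "F x w x \<notin> ?N" using x_sol by (simp add: G_def)
    obtain a where a: "a \<in> interior C" "F x y x = - a" using neg by blast
    obtain c where c: "c \<in> C" "F x y0 x = - c" using y0(3) by blast
    have "t *\<^sub>R a + (1 - t) *\<^sub>R c \<in> interior C"
      using t by (intro interior_cone_add[OF C_convex] interior_cone_scaleR[OF C_cone a(1)]
          mem_cone[OF C_cone c(1)]) auto
    then have "t *\<^sub>R F x y x + (1 - t) *\<^sub>R F x y0 x \<in> ?N"
      using a c by (intro image_eqI[of _ _ "t *\<^sub>R a + (1 - t) *\<^sub>R c"]) auto
    moreover have "t *\<^sub>R F x y x + (1 - t) *\<^sub>R F x y0 x - F x w x \<in> C"
      using ii xK y y0(1) t unfolding C_convex_on_def w_def by auto
    ultimately have "F x w x \<in> ?N" by (rule neg_interior_downward[OF C_convex])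
    with w show False by blast
  qed
  then show ?thesis using xK by blast
qed

end
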